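(* Let $p$ be an odd prime number and $a\in\mathbb{Z}_{\geq1}$ with $\gcd(a,p)=1$. Put $\tau_{p}(a):=\sum_{j=1}^{p-1} j\,p^{ja-1}$. Then \[ b_{\tau_{p}(a)}(a^{-1}) \equiv \left( \frac{-2}{p} \right) \left( \frac{p-1}{2} \right)! \pmod{p}. \]
   Context: $b_n(x)=\sum_{j\ge0}S(n,j)x^j\in\mathbb{Z}[x]$ is the Bell polynomial, where $S(n,j)$ is the Stirling number of the second kind. $a^{-1}$ denotes the inverse of $a$ modulo $p$ and the left side is evaluated in $\mathbb{F}_p$. $\left(\frac{*}{p}\right)$ is the Legendre symbol. *)

theory Defs
  imports
    "HOL-Computational_Algebra.Polynomial"
    "HOL-Number_Theory.Number_Theory"
    "HOL-Combinatorics.Stirling"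
begin

text \<open>
  The sum over all j >= 0 of S(n,j) x^j stops at n, since S(n,j) = 0 for j > n.
\<close>

definition bell_poly :: "nat \<Rightarrow> int poly" where
  "bell_poly n = (\<Sum>j\<le>n. Polynomial.monom (int (Stirling n j)) j)"

lemma coeff_bell_poly: "Polynomial.coeff (bell_poly n) j = int (Stirling n j)"
  by (cases "j \<le> n") (simp_all add: bell_poly_def Polynomial.coeff_sum)

definition tau :: "nat \<Rightarrow> nat \<Rightarrow> nat" where
  "tau p a = (\<Sum>j = 1..p - 1. j * p ^ (j * a - 1))"

end

theory Submission
  imports Defs
begin

text \<open>
  Work in \<open>F\<^sub>p[Y]\<close> with \<open>z = Y\<^sup>p - Y\<close>, the product of all \<open>Y + j\<close>, and let
  \<open>Tr f\<close> be the sum of the translates \<open>f(Y + i)\<close> over \<open>i < p\<close>. The polynomial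
  \<open>R = \<Prod> (Y + j)\<^bsup>p-j\<^esup>\<close> (over \<open>0 < j < p\<close>) satisfies \<open>R(Y + 1) (Y + 1)\<^sup>p = z R\<close>, so
  \<open>f \<mapsto> Tr (R f(Y\<^sup>p))\<close> sends the falling factorial of length \<open>k\<close> to \<open>z\<^sup>k Tr R\<close>. This is the
  umbral description of the Bell polynomials, hence \<open>Tr (R Y\<^bsup>pn\<^esup>) = b\<^sub>n(z) Tr R\<close> for all \<open>n\<close>.

  The logarithmic derivative of \<open>R\<close> gives \<open>z R' = - Y R\<close>, and \<open>Tr (Y R) = 0\<close>, so \<open>Tr R\<close> has
  derivative 0. Being also invariant under translation and of degree below \<open>p\<^sup>2\<close>, it is a
  constant, namely \<open>R(0) = \<Prod> j\<^bsup>p-j\<^esup>\<close>.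

  Now reduce modulo \<open>z - x\<close>, where \<open>a x = 1\<close>. Then \<open>Y\<close> raised to the power \<open>p\<^sup>m\<close> is \<open>Y + m x\<close>, so
  \<open>Y\<^bsup>pn\<^esup>\<close> with \<open>n = \<tau>(a)\<close> becomes \<open>\<Prod> (Y + j)\<^sup>j\<close>, whose product with \<open>R\<close> is the \<open>p\<close>-th power
  of \<open>\<Prod> (Y + j)\<close>. The trace of the latter product is \<open>z' = -1\<close>, so \<open>b\<^sub>n(x) R(0) = -1\<close>. Finally
  \<open>R(0)\<close> is evaluated with Wilson's theorem and Gauss's computation of 2 as a quadratic residue.
\<close>

subsection \<open>Congruence modulo an ideal with two generators\<close>

text \<open>For \<open>m = of_nat p\<close> over \<open>int poly\<close> this is equality in
  F_p[Y]/(F), and \<open>F = 0\<close> gives F_p[Y] itself. One relation thus serves both the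
  polynomial identities and their reduction, without quotient types.\<close>

definition ideal_cong :: "'a::comm_ring_1 \<Rightarrow> 'a \<Rightarrow> 'a \<Rightarrow> 'a \<Rightarrow> bool"
  where "ideal_cong m F f g \<longleftrightarrow> (\<exists>u v. f - g = m * u + F * v)"

abbreviation ideal_cong_syntax  (\<open>(\<open>indent=1 notation=\<open>mixfix ideal_cong\<close>\<close>[_ = _] '(' mod _, _'))\<close>)
  where "[f = g] (mod m, F) \<equiv> ideal_cong m F f g"

lemma ideal_congI: "f - g = m * u + F * v \<Longrightarrow> [f = g] (mod m, F)"
  by (auto simp: ideal_cong_def)

lemma ideal_cong_0_iff: "[f = g] (mod m, 0) \<longleftrightarrow> m dvd f - g"
  by (auto simp: ideal_cong_def dvd_def)

lemma ideal_cong_weaken: "[f = g] (mod m, 0) \<Longrightarrow> [f = g] (mod m, F)"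
  unfolding ideal_cong_def by (metis mult_zero_left mult_zero_right)

lemma ideal_cong_refl [simp]: "[f = f] (mod m, F)"
  by (rule ideal_congI[of _ _ _ 0 _ 0]) simp

lemma ideal_cong_sym:
  assumes "[f = g] (mod m, F)"
  shows "[g = f] (mod m, F)"
proof -
  from assms obtain u v where "f - g = m * u + F * v"
    by (auto simp: ideal_cong_def)
  then have "g - f = m * (- u) + F * (- v)"
    by (simp add: algebra_simps)
  then show ?thesis
    by (rule ideal_congI)
qed

lemma ideal_cong_add:
  assumes "[f = g] (mod m, F)" "[f' = g'] (mod m, F)"
  shows "[f + f' = g + g'] (mod m, F)"
proof -
  from assms obtain u v u' v' where "f - g = m * u + F * v" "f' - g' = m * u' + F * v'"
    unfolding ideal_cong_def by blast
  then have "f + f' - (g + g') = m * (u + u') + F * (v + v')"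
    by (simp add: algebra_simps)
  then show ?thesis
    by (rule ideal_congI)
qed

lemma ideal_cong_trans [trans]:
  assumes "[f = g] (mod m, F)" "[g = h] (mod m, F)"
  shows "[f = h] (mod m, F)"
proof -
  have "[f + g = g + h] (mod m, F)"
    by (rule ideal_cong_add assms)+
  then show ?thesis
    by (simp add: ideal_cong_def algebra_simps)
qed

lemma ideal_cong_mult:
  assumes "[f = g] (mod m, F)" "[f' = g'] (mod m, F)"
  shows "[f * f' = g * g'] (mod m, F)"
proof -
  from assms obtain u v u' v' where *: "f - g = m * u + F * v" "f' - g' = m * u' + F * v'"
    unfolding ideal_cong_def by blast
  have "f * f' - g * g' = (f - g) * f' + g * (f' - g')"
    by (simp add: algebra_simps)
  also have "\<dots> = m * (u * f' + g * u') + F * (v * f' + g * v')"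
    unfolding * by (simp add: algebra_simps)
  finally show ?thesis
    by (rule ideal_congI)
qed

lemma ideal_cong_uminus: "[f = g] (mod m, F) \<Longrightarrow> [- f = - g] (mod m, F)"
  using ideal_cong_mult[of m F "-1" "-1" f g] by simp

lemma ideal_cong_diff:
  "[f = g] (mod m, F) \<Longrightarrow> [f' = g'] (mod m, F) \<Longrightarrow> [f - f' = g - g'] (mod m, F)"
  using ideal_cong_add[of m F f g "- f'" "- g'"] ideal_cong_uminus[of m F f' g'] by simp

lemma ideal_cong_power: "[f = g] (mod m, F) \<Longrightarrow> [f ^ n = g ^ n] (mod m, F)"
  by (induction n) (auto intro: ideal_cong_mult)

lemma ideal_cong_sum:
  "(\<And>i. i \<in> A \<Longrightarrow> [f i = g i] (mod m, F)) \<Longrightarrow> [sum f A = sum g A] (mod m, F)"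
  by (induction A rule: infinite_finite_induct) (auto intro: ideal_cong_add)

lemma ideal_cong_prod:
  "(\<And>i. i \<in> A \<Longrightarrow> [f i = g i] (mod m, F)) \<Longrightarrow> [prod f A = prod g A] (mod m, F)"
  by (induction A rule: infinite_finite_induct) (auto intro: ideal_cong_mult)

lemma ideal_cong_poly:
  fixes q f g m F :: "'a::comm_ring_1 poly"
  assumes "[f = g] (mod m, F)"
  shows "[pcompose q f = pcompose q g] (mod m, F)"
  by (induction q) (auto simp: pcompose_pCons intro!: ideal_cong_add ideal_cong_mult assms)

section \<open>The Frobenius map modulo p\<close>

lemma ideal_cong_power_add_prime:
  fixes f g :: "'a::comm_ring_1"
  assumes "prime p"
  shows "[(f + g) ^ p = f ^ p + g ^ p] (mod of_nat p, F)"
proof -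
  have p: "p > 0"
    using assms by (simp add: prime_gt_0_nat)
  have "(f + g) ^ p = (\<Sum>k\<le>p. of_nat (p choose k) * f ^ k * g ^ (p - k))"
    by (rule binomial_ring)
  also have "{..p} = insert 0 (insert p {1..<p})"
    using p by auto
  also have "(\<Sum>k\<in>\<dots>. of_nat (p choose k) * f ^ k * g ^ (p - k)) =
      f ^ p + g ^ p + (\<Sum>k\<in>{1..<p}. of_nat (p choose k) * f ^ k * g ^ (p - k))"
    using p by (simp add: algebra_simps)
  finally have "(f + g) ^ p - (f ^ p + g ^ p) =
      (\<Sum>k\<in>{1..<p}. of_nat (p choose k) * f ^ k * g ^ (p - k))"
    by simp
  moreover have "of_nat p dvd (\<Sum>k\<in>{1..<p}. of_nat (p choose k) * f ^ k * g ^ (p - k))"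
  proof (rule dvd_sum)
    fix k assume "k \<in> {1..<p}"
    then have "p dvd (p choose k)"
      using assms by (intro dvd_choose_prime) auto
    then have "(of_nat p :: 'a) dvd of_nat (p choose k)"
      by (elim dvdE) simp
    then show "of_nat p dvd of_nat (p choose k) * f ^ k * g ^ (p - k)"
      by (simp add: mult.assoc)
  qed
  ultimately have "of_nat p dvd (f + g) ^ p - (f ^ p + g ^ p)"
    by simp
  then show ?thesis
    by (simp add: ideal_cong_weaken ideal_cong_0_iff)
qed

lemma ideal_cong_power_sum_prime:
  fixes f :: "'b \<Rightarrow> 'a::comm_ring_1"
  assumes "prime p" "finite A"
  shows "[(\<Sum>i\<in>A. f i) ^ p = (\<Sum>i\<in>A. f i ^ p)] (mod of_nat p, F)"
  using assms(2)
proof (induction A rule: finite_induct)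
  case empty
  then show ?case
    using assms(1) by (simp add: power_0_left prime_gt_0_nat)
next
  case (insert x A)
  have "[(f x + sum f A) ^ p = f x ^ p + sum f A ^ p] (mod of_nat p, F)"
    by (rule ideal_cong_power_add_prime[OF assms(1)])
  also have "[\<dots> = f x ^ p + (\<Sum>i\<in>A. f i ^ p)] (mod of_nat p, F)"
    by (intro ideal_cong_add insert.IH) simp
  finally show ?case
    using insert by simp
qed

lemma ideal_cong_of_nat_power_prime:
  assumes "prime p"
  shows "[of_nat n ^ p = of_nat n] (mod of_nat p, F)"
proof (induction n)
  case 0
  then show ?case
    using assms by (simp add: power_0_left prime_gt_0_nat)
next
  case (Suc n)
  have "[(of_nat n + 1) ^ p = of_nat n ^ p + 1 ^ p] (mod of_nat p, F)"
    by (rule ideal_cong_power_add_prime[OF assms])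
  also have "[\<dots> = of_nat n + 1] (mod of_nat p, F)"
    using Suc by (intro ideal_cong_add) auto
  finally show ?case
    by (simp add: add.commute)
qed

text \<open>Lagrange's bound over F_p: splitting off the root n leaves a quotient of lower degree
  that still vanishes modulo p at every i < n, because 0 < n - i < p makes i - n invertible modulo
  p.\<close>

lemma const_dvd_poly_of_roots:
  fixes f :: "int poly"
  assumes p: "prime p"
  shows "n \<le> p \<Longrightarrow> degree f < n \<Longrightarrow> (\<And>i. i < n \<Longrightarrow> int p dvd poly f (int i)) \<Longrightarrow> [:int p:] dvd f"
proof (induction n arbitrary: f)
  case (Suc n)
  let ?q = "synthetic_div f (int n)"
  have f: "f = [:- int n, 1:] * ?q + [:poly f (int n):]"
    using synthetic_div_correct'[of "int n" f] by simp
  have "[:int p:] dvd ?q"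
  proof (cases "degree f = 0")
    case True
    then have "?q = 0"
      by (simp add: synthetic_div_eq_0_iff)
    then show ?thesis
      by simp
  next
    case False
    show ?thesis
    proof (rule Suc.IH)
      show "degree ?q < n" "n \<le> p"
        using Suc.prems False by (auto simp: degree_synthetic_div)
      fix i assume i: "i < n"
      have "poly f (int i) = (int i - int n) * poly ?q (int i) + poly f (int n)"
        by (subst f) (simp add: algebra_simps)
      moreover have "int p dvd poly f (int i)" "int p dvd poly f (int n)"
        using Suc.prems i by auto
      ultimately have "int p dvd (int i - int n) * poly ?q (int i)"
        by (metis dvd_add_left_iff)
      moreover have "\<not> int p dvd int i - int n"
        using i Suc.prems(1) zdvd_not_zless[of "int n - int i" "int p"]
        by (simp add: dvd_diff_commute)
      ultimately show "int p dvd poly ?q (int i)"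
        using p by (simp add: prime_dvd_mult_iff)
    qed
  qed
  moreover have "[:int p:] dvd [:poly f (int n):]"
    using Suc.prems by simp
  ultimately show ?case
    by (subst f) (metis dvd_add dvd_mult)
qed simp

text \<open>Constants embed into (Z/m)[Y]/(F) when F is monic and nonconstant. Dividing
  \<open>u\<close> by F leaves \<open>F * (v + of_nat m * w)\<close> equal to a polynomial of degree
  below that of F, so the cofactor vanishes and m divides c - d.\<close>

lemma const_cong_imp_cong:
  fixes F :: "int poly" and m :: nat
  assumes F: "lead_coeff F = 1" "degree F > 0" and cong: "[ [:c:] = [:d:] ] (mod of_nat m, F)"
  shows "[c = d] (mod int m)"
proof -
  from cong obtain u v where uv: "[:c - d:] = of_nat m * u + F * v"
    by (auto simp: ideal_cong_def)
  have "F \<noteq> 0"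
    using F by auto
  obtain w r where "pseudo_divmod u F = (w, r)"
    by force
  from pseudo_divmod[OF \<open>F \<noteq> 0\<close> this] F have u: "u = F * w + r" and r: "r = 0 \<or> degree r < degree F"
    by auto
  have eq: "F * (v + of_nat m * w) = [:c - d:] - of_nat m * r"
    using uv u by (simp add: algebra_simps)
  have "degree ([:c - d:] - of_nat m * r) < degree F"
    using F(2) r by (intro degree_diff_less) (auto simp: of_nat_poly intro: le_less_trans[OF degree_smult_le])
  moreover have "degree F \<le> degree (F * (v + of_nat m * w))" if "v + of_nat m * w \<noteq> 0"
    using that \<open>F \<noteq> 0\<close> by (simp add: degree_mult_eq)
  ultimately have "v + of_nat m * w = 0"
    unfolding eq by fastforce
  then have "[:c - d:] = [:int m:] * r"
    using eq by (simp add: of_nat_poly)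
  then have "[:int m:] dvd [:c - d:]"
    by (rule dvdI)
  then show ?thesis
    by (simp add: cong_iff_dvd_diff)
qed

subsection \<open>Traces over translates\<close>

lemma pcompose_power: "pcompose (f ^ n) g = pcompose f g ^ n"
  for f :: "'a::comm_semiring_1 poly"
  by (induction n) (simp_all add: pcompose_mult pcompose_1)

lemma pcompose_of_nat: "pcompose (of_nat n) g = of_nat n"
  for g :: "'a::comm_semiring_1 poly"
  by (simp add: of_nat_poly)

lemma pderiv_sum: "pderiv (sum f A) = (\<Sum>x\<in>A. pderiv (f x))"
  by (induction A rule: infinite_finite_induct) (simp_all add: pderiv_add)

lemma power_eq_sum_Stirling:
  fixes x :: "'a::comm_ring_1"
  shows "x ^ n = (\<Sum>j\<le>n. of_nat (Stirling n j) * (\<Prod>i<j. x - of_nat i))"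
proof (induction n)
  case (Suc n)
  define f where "f j = (\<Prod>i<j. x - of_nat i)" for j
  have f_Suc: "x * f j = f (Suc j) + of_nat j * f j" for j
    by (simp add: f_def algebra_simps)
  have "x ^ Suc n = (\<Sum>j\<le>n. of_nat (Stirling n j) * (x * f j))"
    by (simp add: Suc f_def sum_distrib_left mult_ac)
  also have "\<dots> = (\<Sum>j\<le>n. of_nat (Stirling n j) * f (Suc j)) + (\<Sum>j\<le>n. of_nat (j * Stirling n j) * f j)"
    by (simp add: f_Suc distrib_left sum.distrib mult_ac)
  \<comment> \<open>The added term contains S(n, n + 1) = 0. The term at j = 0 is zero as well,
    which allows the index shift that follows.\<close>
  also have "(\<Sum>j\<le>n. of_nat (j * Stirling n j) * f j) = (\<Sum>j\<le>Suc n. of_nat (j * Stirling n j) * f j)"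
    by simp
  also have "\<dots> = (\<Sum>j\<le>n. of_nat (Suc j * Stirling n (Suc j)) * f (Suc j))"
    by (subst sum.atMost_Suc_shift) simp
  also have "(\<Sum>j\<le>n. of_nat (Stirling n j) * f (Suc j)) + \<dots>
      = (\<Sum>j\<le>n. of_nat (Stirling (Suc n) (Suc j)) * f (Suc j))"
    by (simp add: sum.distrib [symmetric] algebra_simps)
  also have "\<dots> = (\<Sum>j\<le>Suc n. of_nat (Stirling (Suc n) j) * f j)"
    by (subst sum.atMost_Suc_shift) simp
  finally show ?case
    by (simp only: f_def)
qed simp

lemma poly_cong_int:
  fixes f :: "int poly"
  assumes "[a = b] (mod m)"
  shows "[poly f a = poly f b] (mod m)"
  by (induction f) (auto intro!: cong_add cong_mult assms)

abbreviation lin :: "nat \<Rightarrow> int poly" where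
  "lin j \<equiv> [:int j, 1:]"

text \<open>Modulo p the translations of Y form the Galois group of F_p(Y) over F_p(Y^p - Y), and
  this is the trace of that extension.\<close>

definition trace_poly :: "nat \<Rightarrow> int poly \<Rightarrow> int poly" where
  "trace_poly p f = (\<Sum>i<p. pcompose f (lin i))"

definition rising :: "nat \<Rightarrow> int poly" where
  "rising p = (\<Prod>j<p. lin j)"

definition artin_schreier :: "nat \<Rightarrow> int poly" where
  "artin_schreier p = [:0, 1:] ^ p - [:0, 1:]"

text \<open>The weight R. Its exponents fall by one from each factor to the next, so translation by
  1 changes R only by one copy of each linear factor and a p-th power.\<close>

definition kernel_poly :: "nat \<Rightarrow> int poly" where
  "kernel_poly p = (\<Prod>j\<in>{1..<p}. lin j ^ (p - j))"

lemma lin_eq: "lin j = [:0, 1:] + of_nat j"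
  by (simp add: of_nat_poly)

lemma pcompose_lin [simp]: "pcompose (lin j) (lin i) = lin (j + i)"
  by (simp add: pcompose_pCons)

section \<open>Arithmetic in F_p[Y] and invariance under translation\<close>

locale prime_modulus =
  fixes p :: nat
  assumes p: "prime p"
begin

abbreviation cong_p :: "int poly \<Rightarrow> int poly \<Rightarrow> bool" (infix \<open>\<simeq>\<close> 50) where
  "f \<simeq> g \<equiv> [f = g] (mod of_nat p, 0)"

lemma cong_p_mult_cancel:
  assumes "c * f \<simeq> c * g" "\<not> [:int p:] dvd c"
  shows "f \<simeq> g"
proof -
  have "prime_elem [:int p:]"
    using p by (simp add: prime_elem_const_poly_iff)
  moreover have "[:int p:] dvd c * (f - g)"
    using assms(1) by (simp add: ideal_cong_0_iff of_nat_poly algebra_simps)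
  ultimately show ?thesis
    using assms(2) by (simp add: prime_elem_dvd_mult_iff ideal_cong_0_iff of_nat_poly)
qed

lemma not_p_dvd_monic:
  assumes "lead_coeff f = 1"
  shows "\<not> [:int p:] dvd f"
proof
  assume "[:int p:] dvd f"
  then have "int p dvd lead_coeff f"
    by (simp add: const_poly_dvd_iff)
  then show False
    using assms p by simp
qed

lemma lin_add_p: "lin (j + p) \<simeq> lin j"
  by (rule ideal_congI[of _ _ _ 1 _ 0]) (simp add: of_nat_poly)

lemma pcompose_lin_p: "pcompose f (lin p) \<simeq> f"
  using ideal_cong_poly[OF lin_add_p[of 0], of f] by simp

lemma pcompose_cong_left:
  assumes "f \<simeq> g"
  shows "pcompose f h \<simeq> pcompose g h"
proof -
  from assms obtain u where "f - g = of_nat p * u"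
    unfolding ideal_cong_def by auto
  then have "pcompose f h - pcompose g h = of_nat p * pcompose u h + 0 * 0"
    by (metis pcompose_diff pcompose_mult pcompose_of_nat add_0_right mult_zero_left)
  then show ?thesis
    by (rule ideal_congI)
qed

lemma trace_poly_cong: "f \<simeq> g \<Longrightarrow> trace_poly p f \<simeq> trace_poly p g"
  unfolding trace_poly_def by (intro ideal_cong_sum pcompose_cong_left)

lemma trace_poly_shift: "trace_poly p (pcompose f (lin 1)) \<simeq> trace_poly p f"
proof -
  have "(\<Sum>i<p. pcompose (pcompose f (lin 1)) (lin i)) = (\<Sum>i<p. pcompose f (lin (Suc i)))"
    by (simp add: pcompose_assoc [symmetric] pcompose_pCons)
  also have "\<dots> = pcompose f (lin p) + (\<Sum>i<p. pcompose f (lin i)) - pcompose f (lin 0)"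
    using sum.lessThan_Suc_shift[of "\<lambda>i. pcompose f (lin i)" p]
    by (simp add: algebra_simps)
  also have "\<dots> \<simeq> f + (\<Sum>i<p. pcompose f (lin i)) - f"
    by (intro ideal_cong_add ideal_cong_diff pcompose_lin_p) simp_all
  finally show ?thesis
    by (simp add: trace_poly_def)
qed

lemma p_gt_0: "p > 0"
  using p by (simp add: prime_gt_0_nat)

lemma lead_coeff_rising: "degree (rising n) = n \<and> lead_coeff (rising n) = 1"
proof -
  have "lead_coeff (rising n) = 1"
    by (simp add: rising_def lead_coeff_prod)
  moreover have "degree (rising n) = n"
    by (simp add: rising_def degree_prod_sum_eq)
  ultimately show ?thesis
    by simp
qed

lemma degree_artin_schreier:
  shows "degree (artin_schreier p) = p" "lead_coeff (artin_schreier p) = 1"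
proof -
  have *: "artin_schreier p = Polynomial.monom 1 p + (- [:0, 1:])"
    by (simp add: artin_schreier_def monom_altdef)
  have "degree (- [:0, 1::int:]) < degree (Polynomial.monom (1::int) p)"
    using prime_gt_1_nat[OF p] by (simp add: degree_monom_eq)
  then show "degree (artin_schreier p) = p"
    unfolding * by (subst degree_add_eq_left) (simp_all add: degree_monom_eq)
  then show "lead_coeff (artin_schreier p) = 1"
    using prime_gt_1_nat[OF p] by (simp add: * coeff_pCons split: nat.splits)
qed

text \<open>Both sides are monic of degree p, so the difference has degree below p. It vanishes at
  each residue i: on the left through the factor with index p - i (or 0 if i = 0), on the right by
  Fermat.\<close>

lemma rising_cong: "rising p \<simeq> artin_schreier p"
proof -
  let ?f = "rising p - artin_schreier p"
  have "degree ?f < p \<or> ?f = 0"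
  proof -
    have "degree ?f \<le> p"
      using lead_coeff_rising degree_artin_schreier by (metis degree_diff_le order_refl)
    moreover have "Polynomial.coeff ?f p = 0"
      using lead_coeff_rising[of p] degree_artin_schreier by auto
    ultimately show ?thesis
      by (metis leading_coeff_0_iff le_neq_implies_less)
  qed
  moreover have "int p dvd poly ?f (int i)" if i: "i < p" for i
  proof -
    have "int p dvd poly (rising p) (int i)"
    proof (cases "i = 0")
      case True
      then have "poly (rising p) (int i) = 0"
        using p_gt_0 by (auto simp: rising_def poly_prod)
      then show ?thesis
        by simp
    next
      case False
      then have "p - i \<in> {..<p}"
        using i by auto
      then have "poly (lin (p - i)) (int i) dvd poly (rising p) (int i)"
        unfolding rising_def poly_prod by (intro dvd_prodI) auto
      then show ?thesis
        using i by (simp add: of_nat_diff)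
    qed
    moreover have "int p dvd int i ^ p - int i"
      using ideal_cong_of_nat_power_prime[OF p, of "0::int" i] by (simp add: ideal_cong_0_iff)
    ultimately show ?thesis
      by (simp add: artin_schreier_def)
  qed
  ultimately have "[:int p:] dvd ?f"
    using const_dvd_poly_of_roots[OF p, of p ?f] by auto
  then show ?thesis
    by (simp add: ideal_cong_0_iff of_nat_poly)
qed

lemma not_p_dvd_artin_schreier: "\<not> [:int p:] dvd artin_schreier p"
  by (rule not_p_dvd_monic) (rule degree_artin_schreier)

lemma artin_schreier_shift: "pcompose (artin_schreier p) (lin i) \<simeq> artin_schreier p"
proof -
  have "([:0, 1:] + of_nat i) ^ p \<simeq> [:0, 1:] ^ p + of_nat i ^ p"
    by (rule ideal_cong_power_add_prime[OF p])
  also have "\<dots> \<simeq> [:0, 1:] ^ p + of_nat i"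
    by (intro ideal_cong_add ideal_cong_of_nat_power_prime p) simp
  finally have "lin i ^ p - lin i \<simeq> [:0, 1:] ^ p + of_nat i - lin i"
    unfolding lin_eq by (intro ideal_cong_diff) simp_all
  also have "[:0, 1:] ^ p + of_nat i - lin i = artin_schreier p"
    by (simp add: lin_eq artin_schreier_def)
  finally show ?thesis
    by (simp add: artin_schreier_def pcompose_diff pcompose_power pcompose_pCons)
qed

text \<open>The trace is linear over F_p[z], since z is invariant under translation.\<close>

lemma trace_poly_artin_schreier_mult:
  "trace_poly p (artin_schreier p * f) \<simeq> artin_schreier p * trace_poly p f"
  unfolding trace_poly_def pcompose_mult sum_distrib_left
  by (intro ideal_cong_sum ideal_cong_mult artin_schreier_shift) simp

subsection \<open>The weight polynomial\<close>

text \<open>After translation, \<open>lin j\<close> has exponent p + 1 - j for j from 2 to p, and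
  \<open>lin 1 ^ p\<close> supplies j = 1. Splitting off one copy of each factor leaves R times a
  translate of \<open>rising p\<close>.\<close>

lemma kernel_poly_shift:
  "pcompose (kernel_poly p) (lin 1) * lin 1 ^ p \<simeq> artin_schreier p * kernel_poly p"
proof -
  have "pcompose (kernel_poly p) (lin 1) = (\<Prod>j\<in>{1..<p}. lin (Suc j) ^ (p - j))"
    by (simp add: kernel_poly_def pcompose_prod pcompose_power pcompose_pCons add.commute)
  also have "\<dots> = (\<Prod>j\<in>{2..<Suc p}. lin j ^ (Suc p - j))"
    by (rule prod.reindex_bij_witness[of _ "\<lambda>j. j - 1" Suc]) auto
  finally have "pcompose (kernel_poly p) (lin 1) * lin 1 ^ p = (\<Prod>j\<in>{1..<Suc p}. lin j ^ (Suc p - j))"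
    using p_gt_0 by (subst prod.atLeast_Suc_lessThan) (simp_all add: numeral_2_eq_2 mult.commute)
  also have "\<dots> = (\<Prod>j\<in>{1..<Suc p}. lin j ^ (p - j)) * (\<Prod>j\<in>{1..<Suc p}. lin j)"
    by (subst prod.distrib [symmetric], rule prod.cong) (auto simp: Suc_diff_le)
  also have "(\<Prod>j\<in>{1..<Suc p}. lin j ^ (p - j)) = kernel_poly p"
    using p_gt_0 by (simp add: kernel_poly_def prod.atLeastLessThan_Suc)
  also have "(\<Prod>j\<in>{1..<Suc p}. lin j) = pcompose (rising p) (lin 1)"
    unfolding rising_def pcompose_prod
    by (rule prod.reindex_bij_witness[of _ "Suc" "\<lambda>j. j - 1"]) (auto simp: pcompose_pCons)
  also have "kernel_poly p * \<dots> \<simeq> kernel_poly p * pcompose (artin_schreier p) (lin 1)"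
    by (intro ideal_cong_mult pcompose_cong_left rising_cong) simp
  also have "\<dots> \<simeq> kernel_poly p * artin_schreier p"
    by (intro ideal_cong_mult artin_schreier_shift) simp
  finally show ?thesis
    by (simp add: mult.commute)
qed

lemma pderiv_rising: "pderiv (rising p) = (\<Sum>k<p. \<Prod>j\<in>{..<p} - {k}. lin j)"
  unfolding rising_def pderiv_prod by (simp add: pderiv_pCons)

lemma pderiv_cong:
  assumes "f \<simeq> g"
  shows "pderiv f \<simeq> pderiv g"
proof -
  from assms obtain u where "f - g = of_nat p * u"
    unfolding ideal_cong_def by auto
  then have "pderiv f - pderiv g = of_nat p * pderiv u + 0 * 0"
    by (metis pderiv_diff pderiv_mult pderiv_of_nat add_0_right mult_zero_left mult_zero_right)
  then show ?thesis
    by (rule ideal_congI)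
qed

lemma pderiv_rising_cong: "pderiv (rising p) \<simeq> - 1"
proof -
  have "pderiv (rising p) \<simeq> pderiv (artin_schreier p)"
    by (intro pderiv_cong rising_cong)
  also have "pderiv (artin_schreier p) = of_nat p * [:0, 1:] ^ (p - 1) - 1"
    by (simp add: artin_schreier_def pderiv_diff pderiv_power pderiv_pCons one_pCons of_nat_poly)
  also have "\<dots> \<simeq> - 1"
    by (rule ideal_congI[of _ _ _ "[:0, 1:] ^ (p - 1)" _ 0]) simp
  finally show ?thesis .
qed

lemma rising_split: "k < p \<Longrightarrow> rising p = lin k * (\<Prod>j\<in>{..<p} - {k}. lin j)"
  unfolding rising_def by (rule prod.remove) auto

text \<open>
  The logarithmic derivative is \<open>- \<Sum> j / (Y + j)\<close>, where \<open>j = (Y + j) - Y\<close>.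
\<close>

lemma kernel_poly_pderiv:
  "artin_schreier p * pderiv (kernel_poly p) \<simeq> - ([:0, 1:] * kernel_poly p)"
proof -
  define h where "h k = (\<Prod>j\<in>{..<p} - {k}. lin j)" for k
  \<comment> \<open>With z written as the product of all \<open>lin k\<close>, each denominator of
    the logarithmic derivative cancels against one factor.\<close>
  have "artin_schreier p * pderiv (kernel_poly p) \<simeq> rising p * pderiv (kernel_poly p)"
    by (intro ideal_cong_mult ideal_cong_sym[OF rising_cong]) simp
  also have "\<dots> = (\<Sum>k\<in>{1..<p}. rising p * ((\<Prod>j\<in>{1..<p} - {k}. lin j ^ (p - j)) * pderiv (lin k ^ (p - k))))"
    by (simp add: kernel_poly_def pderiv_prod sum_distrib_left)
  also have "\<dots> = (\<Sum>k\<in>{1..<p}. kernel_poly p * (of_nat (p - k) * h k))"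
  proof (rule sum.cong[OF refl])
    fix k assume k: "k \<in> {1..<p}"
    then have K: "kernel_poly p = lin k ^ (p - k) * (\<Prod>j\<in>{1..<p} - {k}. lin j ^ (p - j))"
      unfolding kernel_poly_def by (intro prod.remove) auto
    have "lin k * pderiv (lin k ^ (p - k)) = of_nat (p - k) * lin k ^ (p - k)"
      using k power_minus_mult[of "p - k" "lin k"]
      by (simp add: pderiv_power pderiv_pCons of_nat_poly mult.commute)
    then show "rising p * ((\<Prod>j\<in>{1..<p} - {k}. lin j ^ (p - j)) * pderiv (lin k ^ (p - k)))
        = kernel_poly p * (of_nat (p - k) * h k)"
      using rising_split[of k] k unfolding K h_def [symmetric] by (simp del: mult_pCons_left mult_pCons_right)
  qed
  also have "\<dots> = kernel_poly p * (\<Sum>k\<in>{1..<p}. of_nat (p - k) * h k)"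
    by (simp add: sum_distrib_left)
  also have "\<dots> \<simeq> kernel_poly p * (\<Sum>k\<in>{1..<p}. - (of_nat k * h k))"
    by (intro ideal_cong_mult ideal_cong_sum)
      (auto intro!: ideal_congI[of _ _ _ "h _" _ 0] simp: of_nat_diff algebra_simps)
  also have "(\<Sum>k\<in>{1..<p}. - (of_nat k * h k)) = - (\<Sum>k<p. of_nat k * h k)"
    using p_gt_0 by (simp add: sum_negf lessThan_atLeast0 sum.atLeast_Suc_lessThan)
  also have "(\<Sum>k<p. of_nat k * h k) = (\<Sum>k<p. rising p - [:0, 1:] * h k)"
    by (intro sum.cong refl, subst rising_split)
      (simp_all add: h_def [symmetric] lin_eq [symmetric], simp add: of_nat_poly)
  also have "\<dots> = of_nat p * rising p - [:0, 1:] * pderiv (rising p)"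
    by (simp add: sum_subtractf sum_distrib_left pderiv_rising h_def)
  also have "kernel_poly p * - \<dots> \<simeq> kernel_poly p * - (0 - [:0, 1:] * (- 1))"
    by (intro ideal_cong_mult ideal_cong_uminus ideal_cong_diff pderiv_rising_cong)
      (auto intro!: ideal_congI[of _ _ _ "rising p" _ 0])
  finally show ?thesis
    by (simp add: mult.commute)
qed

section \<open>The trace of the weight polynomial\<close>

lemma trace_poly_add: "trace_poly p (f + g) = trace_poly p f + trace_poly p g"
  by (simp add: trace_poly_def pcompose_add sum.distrib)

lemma trace_poly_uminus: "trace_poly p (- f) = - trace_poly p f"
  by (simp add: trace_poly_def pcompose_uminus sum_negf)

lemma trace_poly_of_nat_mult: "trace_poly p (of_nat n * f) = of_nat n * trace_poly p f"
  by (simp add: trace_poly_def pcompose_mult pcompose_of_nat sum_distrib_left)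

lemma trace_poly_sum: "trace_poly p (sum f A) = (\<Sum>x\<in>A. trace_poly p (f x))"
  by (induction A rule: infinite_finite_induct) (simp_all add: trace_poly_add, simp_all add: trace_poly_def)

lemma pderiv_trace_poly: "pderiv (trace_poly p f) = trace_poly p (pderiv f)"
  by (simp add: trace_poly_def pderiv_pcompose pderiv_pCons pderiv_sum)

lemma cong_p_poly:
  assumes "f \<simeq> g"
  shows "[poly f c = poly g c] (mod int p)"
proof -
  from assms obtain u where "f - g = of_nat p * u"
    unfolding ideal_cong_def by auto
  then have "poly f c - poly g c = int p * poly u c"
    by (metis poly_diff poly_mult poly_of_nat)
  then show ?thesis
    by (simp add: cong_iff_dvd_diff)
qed

text \<open>Analogue of the Poisson identity E[X g(X)] = z E[g(X + 1)], with Y^p in the role of X: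
  translation by 1 does not change the trace, and \<open>kernel_poly_shift\<close> then turns the
  factor (Y + 1)^p into z.\<close>

lemma trace_kernel_shift:
  "trace_poly p (kernel_poly p * ([:0, 1:] ^ p * h))
    \<simeq> artin_schreier p * trace_poly p (kernel_poly p * pcompose h (lin 1))"
proof -
  have "trace_poly p (kernel_poly p * ([:0, 1:] ^ p * h))
      \<simeq> trace_poly p (pcompose (kernel_poly p * ([:0, 1:] ^ p * h)) (lin 1))"
    by (rule ideal_cong_sym, rule trace_poly_shift)
  also have "pcompose (kernel_poly p * ([:0, 1:] ^ p * h)) (lin 1)
      = pcompose (kernel_poly p) (lin 1) * lin 1 ^ p * pcompose h (lin 1)"
    by (simp add: pcompose_mult pcompose_power pcompose_pCons mult.assoc)
  also have "trace_poly p \<dots> \<simeq> trace_poly p (artin_schreier p * kernel_poly p * pcompose h (lin 1))"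
    by (intro trace_poly_cong ideal_cong_mult kernel_poly_shift) simp
  also have "\<dots> \<simeq> artin_schreier p * trace_poly p (kernel_poly p * pcompose h (lin 1))"
    unfolding mult.assoc by (rule trace_poly_artin_schreier_mult)
  finally show ?thesis .
qed

text \<open>Write Y = Y^p - z. Both terms contribute z Tr R, the first by the shift rule with h =
  1.\<close>

lemma trace_X_kernel: "trace_poly p ([:0, 1:] * kernel_poly p) \<simeq> 0"
proof -
  have "[:0, 1:] * kernel_poly p = kernel_poly p * ([:0, 1:] ^ p * 1) - artin_schreier p * kernel_poly p"
    by (simp add: artin_schreier_def algebra_simps del: mult_pCons_left mult_pCons_right)
  then have "trace_poly p ([:0, 1:] * kernel_poly p)
      = trace_poly p (kernel_poly p * ([:0, 1:] ^ p * 1)) - trace_poly p (artin_schreier p * kernel_poly p)"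
    using trace_poly_add[of _ "- (artin_schreier p * kernel_poly p)"] trace_poly_uminus by simp
  also have "\<dots> \<simeq> artin_schreier p * trace_poly p (kernel_poly p * pcompose 1 (lin 1))
      - artin_schreier p * trace_poly p (kernel_poly p)"
    by (intro ideal_cong_diff trace_kernel_shift trace_poly_artin_schreier_mult)
  finally show ?thesis
    by (simp add: pcompose_1)
qed

lemma pderiv_trace_kernel: "pderiv (trace_poly p (kernel_poly p)) \<simeq> 0"
proof -
  have "artin_schreier p * trace_poly p (pderiv (kernel_poly p))
      \<simeq> trace_poly p (artin_schreier p * pderiv (kernel_poly p))"
    by (rule ideal_cong_sym, rule trace_poly_artin_schreier_mult)
  also have "\<dots> \<simeq> trace_poly p (- ([:0, 1:] * kernel_poly p))"
    by (intro trace_poly_cong kernel_poly_pderiv)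
  also have "\<dots> = - trace_poly p ([:0, 1:] * kernel_poly p)"
    by (rule trace_poly_uminus)
  also have "\<dots> \<simeq> - 0"
    by (intro ideal_cong_uminus trace_X_kernel)
  finally have "artin_schreier p * trace_poly p (pderiv (kernel_poly p)) \<simeq> artin_schreier p * 0"
    by simp
  then have "trace_poly p (pderiv (kernel_poly p)) \<simeq> 0"
    by (rule cong_p_mult_cancel) (rule not_p_dvd_artin_schreier)
  then show ?thesis
    by (simp add: pderiv_trace_poly)
qed

text \<open>A vanishing derivative gives f = U(Y^p) with U of degree below p. By Fermat U takes the
  same values as f on residues, where f is constant by invariance; hence U minus that constant has p
  roots and is zero modulo p.\<close>

lemma shift_invariant_pderiv_0_imp_const:
  assumes deriv: "pderiv f \<simeq> 0" and shift: "pcompose f (lin 1) \<simeq> f" and deg: "degree f < p * p"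
  shows "f \<simeq> [:poly f 0:]"
proof -
  define U where "U = (\<Sum>k<p. Polynomial.monom (Polynomial.coeff f (k * p)) k)"
  have coeff_U: "Polynomial.coeff U k = (if k < p then Polynomial.coeff f (k * p) else 0)" for k
    by (simp add: U_def coeff_sum if_distrib sum.delta cong: if_cong)
  have coeff_dvd: "int p dvd Polynomial.coeff f n" if np: "\<not> p dvd n" for n
  proof -
    obtain m where m: "n = Suc m"
      using np by (cases n) auto
    have "int p dvd int n * Polynomial.coeff f n"
      using deriv m by (auto simp: ideal_cong_0_iff of_nat_poly const_poly_dvd_iff coeff_pderiv)
    then show ?thesis
      using np p by (simp add: prime_dvd_mult_iff)
  qed
  have compose_U: "pcompose U ([:0, 1:] ^ p) = (\<Sum>k<p. Polynomial.monom (Polynomial.coeff f (k * p)) (k * p))"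
    by (simp add: U_def pcompose_sum monom_altdef pcompose_smult pcompose_power pcompose_pCons
        power_mult [symmetric] mult.commute)
  \<comment> \<open>A vanishing derivative only leaves the exponents divisible by \<open>p\<close>.\<close>
  have f_U: "f \<simeq> pcompose U ([:0, 1:] ^ p)"
  proof -
    have "int p dvd Polynomial.coeff (f - pcompose U ([:0, 1:] ^ p)) n" for n
    proof (cases "p dvd n")
      case False
      then have "Polynomial.coeff (pcompose U ([:0, 1:] ^ p)) n = 0"
        by (auto simp: compose_U coeff_sum intro!: sum.neutral)
      then show ?thesis
        using coeff_dvd[OF False] by simp
    next
      case True
      then obtain k where n: "n = k * p"
        by (metis dvd_def mult.commute)
      have "Polynomial.coeff (pcompose U ([:0, 1:] ^ p)) n
          = (\<Sum>j<p. if j = k then Polynomial.coeff f (k * p) else 0)"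
        unfolding compose_U coeff_sum n using p_gt_0 by (intro sum.cong) auto
      also have "\<dots> = Polynomial.coeff f n"
        \<comment> \<open>For k >= p the sum is empty of matches, and the coefficient is zero
          because k * p lies beyond the degree of f.\<close>
        using less_le_trans[OF deg mult_le_mono1[of p k p]] by (auto simp: n coeff_eq_0)
      finally show ?thesis
        by simp
    qed
    then show ?thesis
      by (simp add: ideal_cong_0_iff of_nat_poly const_poly_dvd_iff)
  qed
  have const_value: "[poly f (int i) = poly f 0] (mod int p)" for i
  proof (induction i)
    case (Suc i)
    have "[poly f (int (Suc i)) = poly f (int i)] (mod int p)"
      using cong_p_poly[OF shift, of "int i"] by (simp add: poly_pcompose add.commute)
    then show ?case
      using Suc cong_trans by blast
  qed simp
  have "[:int p:] dvd U - [:poly f 0:]"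
  proof (rule const_dvd_poly_of_roots[OF p order_refl])
    have "degree U < p"
      using p_gt_0 by (intro degree_lessI) (auto simp: coeff_U)
    then show "degree (U - [:poly f 0:]) < p"
      using p_gt_0 by (intro degree_diff_less) auto
    fix i
    have "[int i = int i ^ p] (mod int p)"
      using ideal_cong_of_nat_power_prime[OF p, of "0::int" i]
      by (simp add: ideal_cong_0_iff cong_iff_dvd_diff dvd_diff_commute)
    then have "[poly U (int i) = poly U (int i ^ p)] (mod int p)"
      by (rule poly_cong_int)
    also have "poly U (int i ^ p) = poly (pcompose U ([:0, 1:] ^ p)) (int i)"
      by (simp add: poly_pcompose)
    also have "[\<dots> = poly f (int i)] (mod int p)"
      by (rule cong_p_poly, rule ideal_cong_sym, rule f_U)
    also note const_value
    finally show "int p dvd poly (U - [:poly f 0:]) (int i)"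
      by (simp add: cong_iff_dvd_diff)
  qed
  then have "U \<simeq> [:poly f 0:]"
    by (simp add: ideal_cong_0_iff of_nat_poly)
  then have "pcompose U ([:0, 1:] ^ p) \<simeq> pcompose [:poly f 0:] ([:0, 1:] ^ p)"
    by (rule pcompose_cong_left)
  with f_U show ?thesis
    by (metis pcompose_const ideal_cong_trans)
qed

lemma trace_kernel: "trace_poly p (kernel_poly p) \<simeq> [:\<Prod>j\<in>{1..<p}. int j ^ (p - j):]"
proof -
  let ?T = "trace_poly p (kernel_poly p)"
  have "degree (kernel_poly p) \<le> (\<Sum>j\<in>{1..<p}. degree (lin j ^ (p - j)))"
    unfolding kernel_poly_def by (rule degree_prod_sum_le[unfolded o_def]) simp
  also have "\<dots> \<le> (\<Sum>j\<in>{1..<p}. p)"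
    by (intro sum_mono order_trans[OF degree_power_le]) simp
  also have "\<dots> < p * p"
    using p_gt_0 by simp
  finally have "degree (kernel_poly p) < p * p" .
  then have "degree (pcompose (kernel_poly p) (lin i)) < p * p" for i
    by (simp add: degree_pcompose)
  then have deg: "degree ?T < p * p"
    unfolding trace_poly_def using p_gt_0 by (intro degree_sum_less) auto
  have "pcompose ?T (lin 1) = trace_poly p (pcompose (kernel_poly p) (lin 1))"
    by (simp add: trace_poly_def pcompose_sum pcompose_assoc [symmetric] pcompose_pCons add.commute)
  then have "pcompose ?T (lin 1) \<simeq> ?T"
    using trace_poly_shift by simp
  from shift_invariant_pderiv_0_imp_const[OF pderiv_trace_kernel this deg]
  have "?T \<simeq> [:poly ?T 0:]" .
  also have "\<dots> \<simeq> [:\<Prod>j\<in>{1..<p}. int j ^ (p - j):]"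
  proof -
    have "poly ?T 0 = (\<Sum>i<p. poly (kernel_poly p) (int i))"
      by (simp add: trace_poly_def poly_sum poly_pcompose)
    also have "\<dots> = poly (kernel_poly p) 0 + (\<Sum>i\<in>{1..<p}. poly (kernel_poly p) (int i))"
      using p_gt_0 by (simp add: lessThan_atLeast0 sum.atLeast_Suc_lessThan)
    finally have *: "poly ?T 0 - poly (kernel_poly p) 0 = (\<Sum>i\<in>{1..<p}. poly (kernel_poly p) (int i))"
      by simp
    have "int p dvd (\<Sum>i\<in>{1..<p}. poly (kernel_poly p) (int i))"
    proof (rule dvd_sum)
      fix i assume i: "i \<in> {1..<p}"
      \<comment> \<open>At the point i the factor with index p - i takes the value p, raised to the
        positive power i. Only the translate with i = 0 therefore contributes to the
        constant.\<close>
      then have "poly (lin (p - i) ^ (p - (p - i))) (int i) dvd poly (kernel_poly p) (int i)"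
        unfolding kernel_poly_def poly_prod by (intro dvd_prodI) auto
      moreover have "int p dvd poly (lin (p - i) ^ (p - (p - i))) (int i)"
        using i by (simp add: of_nat_diff dvd_power)
      ultimately show "int p dvd poly (kernel_poly p) (int i)"
        by (rule dvd_trans[rotated])
    qed
    then show ?thesis
      unfolding * [symmetric]
      by (simp add: ideal_cong_0_iff of_nat_poly kernel_poly_def poly_prod)
  qed
  finally show ?thesis .
qed

section \<open>Umbral moments of the weight and Bell polynomials\<close>

lemma trace_kernel_falling:
  "trace_poly p (kernel_poly p * (\<Prod>i<k. [:0, 1:] ^ p - of_nat i))
    \<simeq> artin_schreier p ^ k * trace_poly p (kernel_poly p)"
proof (induction k)
  case (Suc k)
  \<comment> \<open>The factor Y^p of the falling factorial is traded for z. The translation this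
    costs lowers each remaining Y^p - (i + 1) to Y^p - i, because (Y + 1)^p = Y^p + 1 modulo p, so
    the falling factorial of length k reappears.\<close>
  let ?h = "\<Prod>i<k. [:0, 1:] ^ p - of_nat (Suc i) :: int poly"
  have *: "(\<Prod>i<Suc k. [:0, 1:] ^ p - of_nat i) = ([:0, 1:] ^ p * ?h :: int poly)"
    by (subst prod.lessThan_Suc_shift) simp
  have "pcompose ?h (lin 1) = (\<Prod>i<k. lin 1 ^ p - of_nat (Suc i))"
    by (simp only: pcompose_prod pcompose_diff pcompose_power pcompose_of_nat)
      (simp add: pcompose_pCons)
  also have "\<dots> \<simeq> (\<Prod>i<k. [:0, 1:] ^ p - of_nat i)"
  proof (rule ideal_cong_prod)
    fix i
    have "lin 1 = [:0, 1:] + 1"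
      by (simp add: one_pCons)
    then have "lin 1 ^ p \<simeq> [:0, 1:] ^ p + 1"
      using ideal_cong_power_add_prime[OF p, of 0 "[:0, 1:]" "1 :: int poly"]
      by (simp only: power_one)
    then have "lin 1 ^ p - of_nat (Suc i) \<simeq> [:0, 1:] ^ p + 1 - of_nat (Suc i)"
      by (intro ideal_cong_diff) simp_all
    then show "lin 1 ^ p - of_nat (Suc i) \<simeq> [:0, 1:] ^ p - of_nat i"
      by simp
  qed
  finally have h: "pcompose ?h (lin 1) \<simeq> (\<Prod>i<k. [:0, 1:] ^ p - of_nat i)" .
  have "trace_poly p (kernel_poly p * ([:0, 1:] ^ p * ?h))
      \<simeq> artin_schreier p * trace_poly p (kernel_poly p * pcompose ?h (lin 1))"
    by (rule trace_kernel_shift)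
  also have "\<dots> \<simeq> artin_schreier p * trace_poly p (kernel_poly p * (\<Prod>i<k. [:0, 1:] ^ p - of_nat i))"
    by (intro ideal_cong_mult trace_poly_cong h) simp_all
  also have "\<dots> \<simeq> artin_schreier p * (artin_schreier p ^ k * trace_poly p (kernel_poly p))"
    by (intro ideal_cong_mult Suc) simp
  finally show ?case
    unfolding * by (simp add: mult.assoc)
qed simp

lemma trace_kernel_power:
  "trace_poly p (kernel_poly p * ([:0, 1:] ^ p) ^ n)
    \<simeq> pcompose (bell_poly n) (artin_schreier p) * trace_poly p (kernel_poly p)"
proof -
  have "kernel_poly p * ([:0, 1:] ^ p) ^ n
      = (\<Sum>j\<le>n. of_nat (Stirling n j) * (kernel_poly p * (\<Prod>i<j. [:0, 1:] ^ p - of_nat i)))"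
    by (subst power_eq_sum_Stirling) (simp only: sum_distrib_left mult_ac)
  then have "trace_poly p (kernel_poly p * ([:0, 1:] ^ p) ^ n)
      = (\<Sum>j\<le>n. of_nat (Stirling n j) * trace_poly p (kernel_poly p * (\<Prod>i<j. [:0, 1:] ^ p - of_nat i)))"
    by (simp only: trace_poly_sum trace_poly_of_nat_mult)
  also have "\<dots> \<simeq> (\<Sum>j\<le>n. of_nat (Stirling n j) * (artin_schreier p ^ j * trace_poly p (kernel_poly p)))"
    by (intro ideal_cong_sum ideal_cong_mult trace_kernel_falling) simp
  also have "\<dots> = pcompose (bell_poly n) (artin_schreier p) * trace_poly p (kernel_poly p)"
    by (simp add: bell_poly_def pcompose_sum monom_altdef pcompose_smult pcompose_power pcompose_pCons
        sum_distrib_right of_nat_poly mult.assoc)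
  finally show ?thesis .
qed

subsection \<open>Reduction modulo an Artin-Schreier polynomial\<close>

text \<open>Translating z / Y by k gives z / (Y + k), the product with the factor
  \<open>lin k\<close> left out. By the product rule these add up to the derivative of
  \<open>rising p\<close>.\<close>

lemma trace_rising_quotient: "trace_poly p (\<Prod>j\<in>{1..<p}. lin j) \<simeq> - 1"
proof -
  let ?h = "\<Prod>j\<in>{1..<p}. lin j"
  have rising: "rising p = lin 0 * ?h"
    using p_gt_0 unfolding rising_def lessThan_atLeast0 by (subst prod.atLeast_Suc_lessThan) simp_all
  have "pcompose ?h (lin k) \<simeq> (\<Prod>j\<in>{..<p} - {k}. lin j)" if k: "k < p" for k
  proof (rule cong_p_mult_cancel)
    have "lin k * pcompose ?h (lin k) = pcompose (rising p) (lin k)"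
      unfolding rising pcompose_mult by (simp only: pcompose_lin add_0)
    also have "\<dots> \<simeq> pcompose (artin_schreier p) (lin k)"
      by (intro pcompose_cong_left rising_cong)
    also have "\<dots> \<simeq> artin_schreier p"
      by (rule artin_schreier_shift)
    also have "\<dots> \<simeq> rising p"
      by (rule ideal_cong_sym, rule rising_cong)
    also have "rising p = lin k * (\<Prod>j\<in>{..<p} - {k}. lin j)"
      by (rule rising_split[OF k])
    finally show "lin k * pcompose ?h (lin k) \<simeq> lin k * (\<Prod>j\<in>{..<p} - {k}. lin j)" .
    show "\<not> [:int p:] dvd lin k"
      by (rule not_p_dvd_monic) simp
  qed
  then have "trace_poly p ?h \<simeq> (\<Sum>k<p. \<Prod>j\<in>{..<p} - {k}. lin j)"
    unfolding trace_poly_def by (intro ideal_cong_sum) simp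
  also have "\<dots> = pderiv (rising p)"
    by (rule pderiv_rising [symmetric])
  also note pderiv_rising_cong
  finally show ?thesis .
qed

text \<open>Modulo F the relation Y^p = Y + x holds, so each application of Frobenius adds
  x.\<close>

lemma lin_frobenius_power:
  fixes x :: nat
  defines "F \<equiv> artin_schreier p - of_nat x"
  shows "[lin i ^ (p ^ m) = lin i + of_nat (m * x)] (mod of_nat p, F)"
proof (induction m)
  case (Suc m)
  have "lin i ^ (p ^ Suc m) = (lin i ^ (p ^ m)) ^ p"
    by (simp add: power_mult [symmetric] mult.commute)
  also have "[\<dots> = (lin i + of_nat (m * x)) ^ p] (mod of_nat p, F)"
    by (rule ideal_cong_power[OF Suc])
  also have "lin i + of_nat (m * x) = [:0, 1:] + of_nat (i + m * x)"
    by (simp add: lin_eq)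
  also have "[([:0, 1:] + of_nat (i + m * x)) ^ p
      = [:0, 1:] ^ p + of_nat (i + m * x) ^ p] (mod of_nat p, F)"
    by (rule ideal_cong_power_add_prime[OF p])
  also have "[\<dots> = ([:0, 1:] + of_nat x) + of_nat (i + m * x)] (mod of_nat p, F)"
    by (intro ideal_cong_add ideal_cong_of_nat_power_prime p ideal_congI[of _ _ _ 0 _ 1])
      (simp add: F_def artin_schreier_def)
  also have "\<dots> = lin i + of_nat (Suc m * x)"
    by (simp add: lin_eq)
  finally show ?case .
qed simp

text \<open>Since p tau(a) is the sum of j p^(ja) and a x = 1, the power of Y becomes the product of
  \<open>lin j ^ j\<close>. This complements the exponents p - j of R to p throughout.\<close>

lemma trace_kernel_power_tau:
  fixes a x :: nat
  assumes ax: "[a * x = 1] (mod p)" and a: "a \<ge> 1"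
  defines "F \<equiv> artin_schreier p - of_nat x"
  shows "[trace_poly p (kernel_poly p * ([:0, 1:] ^ p) ^ tau p a) = (- 1) ^ p] (mod of_nat p, F)"
proof -
  let ?h = "\<Prod>j\<in>{1..<p}. lin j"
  have frob: "[lin i ^ (p ^ (j * a)) = lin (j + i)] (mod of_nat p, F)" for i j
  proof -
    have "[j * (a * x) = j * 1] (mod p)"
      by (intro cong_mult ax) simp
    then have "[j * a * x = j] (mod p)"
      by (simp add: mult.assoc)
    then have "[int (j * a * x) = int j] (mod int p)"
      by (simp only: cong_int_iff)
    then have "(of_nat (j * a * x) :: int poly) \<simeq> of_nat j"
      by (simp add: ideal_cong_0_iff of_nat_poly cong_iff_dvd_diff)
    note j = ideal_cong_weaken[OF this, of F]
    have "[lin i ^ (p ^ (j * a)) = lin i + of_nat (j * a * x)] (mod of_nat p, F)"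
      unfolding F_def by (rule lin_frobenius_power)
    also have "[\<dots> = lin i + of_nat j] (mod of_nat p, F)"
      by (rule ideal_cong_add[OF ideal_cong_refl j])
    also have "lin i + of_nat j = lin (j + i)"
      by (simp add: of_nat_poly)
    finally show ?thesis .
  qed
  have "p * tau p a = (\<Sum>j = 1..p - 1. p ^ (j * a) * j)"
    unfolding tau_def sum_distrib_left
  proof (intro sum.cong refl)
    fix j assume "j \<in> {1..p - 1}"
    then have "j * a > 0"
      \<comment> \<open>Positivity makes \<open>j * a - 1\<close> a true predecessor, so the extra
        factor p restores \<open>p ^ (j * a)\<close>.\<close>
      using a by simp
    then show "p * (j * p ^ (j * a - 1)) = p ^ (j * a) * j"
      using power_minus_mult[of "j * a" p] by (simp add: mult_ac)
  qed
  also have "{1..p - 1} = {1..<p}"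
    by auto
  finally have tau: "([:0, 1:] ^ p) ^ tau p a = (\<Prod>j\<in>{1..<p}. ([:0, 1 :: int:] ^ (p ^ (j * a))) ^ j)"
    by (simp add: power_mult [symmetric] power_sum)
  have "[pcompose (kernel_poly p * ([:0, 1:] ^ p) ^ tau p a) (lin i) = pcompose ?h (lin i) ^ p]
      (mod of_nat p, F)" for i
  proof -
    have "pcompose (kernel_poly p * ([:0, 1:] ^ p) ^ tau p a) (lin i)
        = (\<Prod>j\<in>{1..<p}. lin (j + i) ^ (p - j) * (lin i ^ (p ^ (j * a))) ^ j)"
      unfolding tau kernel_poly_def
      by (simp only: pcompose_mult pcompose_prod pcompose_power pcompose_lin prod.distrib)
        (simp add: pcompose_pCons)
    moreover have "[(\<Prod>j\<in>{1..<p}. lin (j + i) ^ (p - j) * (lin i ^ (p ^ (j * a))) ^ j)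
        = (\<Prod>j\<in>{1..<p}. lin (j + i) ^ (p - j) * lin (j + i) ^ j)] (mod of_nat p, F)"
      by (rule ideal_cong_prod, rule ideal_cong_mult[OF ideal_cong_refl ideal_cong_power[OF frob]])
    moreover have "(\<Prod>j\<in>{1..<p}. lin (j + i) ^ (p - j) * lin (j + i) ^ j) = (\<Prod>j\<in>{1..<p}. lin (j + i) ^ p)"
    proof (rule prod.cong[OF refl])
      fix j assume "j \<in> {1..<p}"
      then have "(p - j) + j = p"
        by simp
      then show "lin (j + i) ^ (p - j) * lin (j + i) ^ j = lin (j + i) ^ p"
        by (simp only: power_add [symmetric])
    qed
    moreover have "(\<Prod>j\<in>{1..<p}. lin (j + i) ^ p) = pcompose ?h (lin i) ^ p"
      by (simp only: pcompose_prod pcompose_lin prod_power_distrib)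
    ultimately show ?thesis
      by (simp only:)
  qed
  then have "[trace_poly p (kernel_poly p * ([:0, 1:] ^ p) ^ tau p a)
      = (\<Sum>i<p. pcompose ?h (lin i) ^ p)] (mod of_nat p, F)"
    unfolding trace_poly_def by (rule ideal_cong_sum)
  \<comment> \<open>Frobenius is additive, so the p-th power moves outside the sum over
    translates.\<close>
  also have "[\<dots> = trace_poly p ?h ^ p] (mod of_nat p, F)"
    unfolding trace_poly_def
    by (rule ideal_cong_sym, rule ideal_cong_power_sum_prime[OF p]) simp
  also have "[\<dots> = (- 1) ^ p] (mod of_nat p, F)"
    by (rule ideal_cong_power[OF ideal_cong_weaken[OF trace_rising_quotient]])
  finally show ?thesis .
qed

text \<open>Modulo F = z - x the argument z of the Bell polynomial becomes the constant x, and the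
  two evaluations of the same trace become congruent constants. As F is monic of degree p, this
  descends to a congruence of integers modulo p.\<close>

lemma bell_poly_tau_cong:
  fixes a x :: nat
  assumes ax: "[a * x = 1] (mod p)" and a: "a \<ge> 1"
  shows "[poly (bell_poly (tau p a)) (int x) * (\<Prod>j\<in>{1..<p}. int j ^ (p - j)) = (- 1) ^ p] (mod int p)"
proof (rule const_cong_imp_cong)
  let ?F = "artin_schreier p - of_nat x" and ?b = "bell_poly (tau p a)"
  let ?V = "\<Prod>j\<in>{1..<p}. int j ^ (p - j)"
  have deg: "degree (artin_schreier p + (- of_nat x)) = degree (artin_schreier p)"
    using p_gt_0 by (intro degree_add_eq_left) (simp add: degree_artin_schreier)
  then have deg: "degree ?F = p"
    by (simp add: degree_artin_schreier)
  then show "degree ?F > 0"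
    using p_gt_0 by simp
  show "lead_coeff ?F = 1"
    unfolding deg using p_gt_0 degree_artin_schreier
    by (simp add: of_nat_poly coeff_pCons split: nat.splits)
  have "[artin_schreier p = [:int x:]] (mod of_nat p, ?F)"
    by (rule ideal_congI[of _ _ _ 0 _ 1]) (simp add: of_nat_poly)
  then have "[pcompose ?b (artin_schreier p) = pcompose ?b [:int x:]] (mod of_nat p, ?F)"
    by (rule ideal_cong_poly)
  then have "[pcompose ?b [:int x:] * [:?V:]
      = pcompose ?b (artin_schreier p) * trace_poly p (kernel_poly p)] (mod of_nat p, ?F)"
    by (intro ideal_cong_mult ideal_cong_sym[OF ideal_cong_weaken[OF trace_kernel]], elim ideal_cong_sym)
  also have "[\<dots> = trace_poly p (kernel_poly p * ([:0, 1:] ^ p) ^ tau p a)] (mod of_nat p, ?F)"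
    by (rule ideal_cong_sym[OF ideal_cong_weaken[OF trace_kernel_power]])
  also have "[\<dots> = (- 1) ^ p] (mod of_nat p, ?F)"
    by (rule trace_kernel_power_tau[OF ax a])
  finally show "[ [:poly ?b (int x) * ?V:] = [:(- 1) ^ p:] ] (mod of_nat p, ?F)"
    by (simp add: pcompose_pCons_0 poly_const_pow [symmetric] one_pCons mult.commute)
qed

end

subsection \<open>The constant\<close>

lemma prod_fold_half:
  fixes f :: "nat \<Rightarrow> 'a::comm_monoid_mult"
  shows "(\<Prod>j = 1..2 * q. f j) = (\<Prod>j = 1..q. f j * f (2 * q + 1 - j))"
proof -
  have "(\<Prod>j = 1..q + q. f j) = (\<Prod>j = 1..q. f j) * (\<Prod>j = q + 1..q + q. f j)"
    by (rule prod.ub_add_nat) simp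
  also have "(\<Prod>j = q + 1..q + q. f j) = (\<Prod>j = 1..q. f (2 * q + 1 - j))"
    by (rule prod.reindex_bij_witness[of _ "\<lambda>j. 2 * q + 1 - j" "\<lambda>j. 2 * q + 1 - j"]) auto
  finally show ?thesis
    by (simp add: prod.distrib mult_2)
qed

text \<open>
  Modulo \<open>2 q + 1\<close> the left-hand side is \<open>\<Prod> (- 1)\<^sup>j j\<close>.
\<close>

lemma prod_alternating_eq_prod_even:
  "(\<Prod>j = 1..q. if even j then int j else int (2 * q + 1 - j)) = 2 ^ q * fact q"
proof -
  have "(\<Prod>j = 1..q. if even j then int j else int (2 * q + 1 - j)) = (\<Prod>j = 1..q. 2 * int j)"
    \<comment> \<open>The left factors are the even numbers 2, ..., 2 q: those up to q are the even
      j, and those above q are 2 q + 1 - j for odd j. The witnesses are doubling and halving under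
      this correspondence.\<close>
    by (rule prod.reindex_bij_witness[of _ "\<lambda>j. if 2 * j \<le> q then 2 * j else 2 * q + 1 - 2 * j"
          "\<lambda>j. if even j then j div 2 else (2 * q + 1 - j) div 2"])
      (auto elim!: evenE oddE simp: of_nat_diff simp flip: diff_mult_distrib2)
  also have "\<dots> = 2 ^ q * fact q"
    by (simp add: prod.distrib fact_prod)
  finally show ?thesis .
qed

text \<open>Pairing j with p - j turns each pair of factors into (-1)^j j^p, which is (-1)^j j by
  Fermat; so the product is E modulo p. Gauss's rearrangement gives E = 2^q q! modulo p, Euler's
  criterion replaces the Legendre symbol by (-2)^q, and what remains is (-1)^q E^2.\<close>

lemma prod_power_complement_cong:
  assumes p: "prime p" "odd p"
  shows "[(\<Prod>j\<in>{1..<p}. int j ^ (p - j)) * (Legendre (-2) (int p) * fact ((p - 1) div 2)) = - 1] (mod int p)"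
proof -
  define q where "q = (p - 1) div 2"
  have pq: "p = 2 * q + 1"
    using p unfolding q_def by (auto elim: oddE)
  define E where "E = (\<Prod>j = 1..q. (- 1) ^ j * int j)"
  have neg: "[int (p - j) = - int j] (mod int p)" if "j \<le> p" for j
    using that by (simp add: cong_iff_dvd_diff of_nat_diff)
  have fermat: "[int j ^ p = int j] (mod int p)" for j
    using ideal_cong_of_nat_power_prime[OF p(1), of "0::int" j]
    by (simp add: ideal_cong_0_iff cong_iff_dvd_diff)
  have "{1..<p} = {1..2 * q}"
    using pq by auto
  then have "(\<Prod>j\<in>{1..<p}. int j ^ (p - j)) = (\<Prod>j = 1..q. int j ^ (p - j) * int (p - j) ^ (p - (p - j)))"
    by (simp only: prod_fold_half pq)
  also have "[\<dots> = (\<Prod>j = 1..q. int j ^ (p - j) * (- int j) ^ (p - (p - j)))] (mod int p)"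
    by (intro cong_prod cong_mult cong_pow neg) (auto simp: pq)
  also have "(\<Prod>j = 1..q. int j ^ (p - j) * (- int j) ^ (p - (p - j))) = (\<Prod>j = 1..q. (- 1) ^ j * int j ^ p)"
  proof (rule prod.cong[OF refl])
    fix j assume "j \<in> {1..q}"
    then have "p - (p - j) = j" and "p - j + j = p"
      by (auto simp: pq)
    then show "int j ^ (p - j) * (- int j) ^ (p - (p - j)) = (- 1) ^ j * int j ^ p"
      by (metis (no_types, lifting) mult.left_commute power_add power_minus)
  qed
  also have "[\<dots> = E] (mod int p)"
    unfolding E_def by (intro cong_prod cong_mult fermat) simp
  finally have V: "[(\<Prod>j\<in>{1..<p}. int j ^ (p - j)) = E] (mod int p)" .

  have "[(\<Prod>j = 1..q. if even j then int j else int (2 * q + 1 - j)) = E] (mod int p)"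
    unfolding E_def
  proof (rule cong_prod)
    fix j assume "j \<in> {1..q}"
    then show "[(if even j then int j else int (2 * q + 1 - j)) = (- 1) ^ j * int j] (mod int p)"
      using neg[of j] pq by auto
  qed
  then have two: "[2 ^ q * fact q = E] (mod int p)"
    by (simp only: prod_alternating_eq_prod_even)

  \<comment> \<open>The signs in E disappear on squaring; Wilson's theorem, with j again paired with
    p - j, then evaluates (-1)^q (q!)^2.\<close>
  have "E * E = fact q * fact q"
    by (simp add: E_def fact_prod prod.distrib [symmetric] power_mult_distrib [symmetric] mult_ac)
  have "fact (p - 1) = (\<Prod>j = 1..q. int j * int (p - j))"
    using pq by (simp only: fact_prod prod_fold_half of_nat_prod of_nat_mult add_diff_cancel_right')
  also have "[\<dots> = (\<Prod>j = 1..q. int j * - int j)] (mod int p)"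
    by (intro cong_prod cong_mult neg) (auto simp: pq)
  also have "(\<Prod>j = 1..q. int j * - int j) = (\<Prod>j = 1..q. (- 1) * (int j * int j))"
    by simp
  also have "\<dots> = (- 1) ^ q * (fact q * fact q)"
    unfolding prod.distrib by (simp add: fact_prod)
  finally have "[(- 1) ^ q * (fact q * fact q) = - 1] (mod int p)"
    using wilson_theorem[OF p(1)] by (metis cong_sym cong_trans)
  then have wilson: "[(- 1) ^ q * (E * E) = - 1] (mod int p)"
    by (simp only: \<open>E * E = fact q * fact q\<close>)

  have "p > 2"
    using p prime_gt_1_nat[of p] by (cases "p = 2") auto
  then have "[Legendre (- 2) (int p) = (- 2) ^ q] (mod int p)"
    using euler_criterion[OF p(1)] by (simp add: q_def)
  then have "[(\<Prod>j\<in>{1..<p}. int j ^ (p - j)) * (Legendre (- 2) (int p) * fact q)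
      = E * ((- 2) ^ q * fact q)] (mod int p)"
    by (intro cong_mult V) simp_all
  also have "E * ((- 2) ^ q * fact q) = (- 1) ^ q * (E * (2 ^ q * fact q))"
    by (simp add: power_minus[of 2] mult_ac)
  also have "[\<dots> = (- 1) ^ q * (E * E)] (mod int p)"
    by (intro cong_mult two) simp_all
  also note wilson
  finally show ?thesis
    by (simp only: q_def)
qed

theorem theorem4p1:
  fixes p a :: nat
  assumes "prime p" and "odd p" and "a \<ge> 1" and "coprime a p"
  shows "[poly (bell_poly (tau p a)) (modular_inverse (int p) (int a))
          = Legendre (-2) (int p) * fact ((p - 1) div 2)] (mod int p)"
proof -
  interpret prime_modulus p
    by unfold_locales (rule assms)
  define x where "x = nat (modular_inverse (int p) (int a))"
  let ?b = "poly (bell_poly (tau p a)) (int x)"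
  let ?V = "\<Prod>j\<in>{1..<p}. int j ^ (p - j)"
  let ?c = "Legendre (-2) (int p) * fact ((p - 1) div 2)"
  have x: "modular_inverse (int p) (int a) = int x"
    using modular_inverse_int_nonneg[of "int p" "int a"] p_gt_0 by (simp add: x_def)
  have "[int a * int x = 1] (mod int p)"
    using cong_modular_inverse1[of "int a" "int p"] assms(4) unfolding x by simp
  then have "[a * x = 1] (mod p)"
    by (metis cong_int_iff of_nat_1 of_nat_mult)
  then have bV: "[?b * ?V = - 1] (mod int p)"
    using bell_poly_tau_cong[of a x] assms by simp
  have "[?V * ?c = - 1] (mod int p)"
    by (rule prod_power_complement_cong) (rule assms)+
  \<comment> \<open>Thus \<open>- ?c\<close> is an inverse of \<open>?V\<close> modulo p, and
    multiplying \<open>bV\<close> by it isolates \<open>?b\<close>.\<close>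
  then have "[- (?V * ?c) = 1] (mod int p)"
    using cong_minus_minus_iff[of "?V * ?c" "-1" "int p"] by simp
  then have "[?b * (- (?V * ?c)) = ?b * 1] (mod int p)"
    by (rule cong_mult[OF cong_refl])
  moreover have "[(?b * ?V) * (- ?c) = (- 1) * (- ?c)] (mod int p)"
    by (rule cong_mult[OF bV cong_refl])
  moreover have "?b * (- (?V * ?c)) = (?b * ?V) * (- ?c)"
    by (simp only: mult.assoc mult_minus_right)
  ultimately have "[?b * 1 = (- 1) * (- ?c)] (mod int p)"
    unfolding cong_def by metis
  then have "[?b = ?c] (mod int p)"
    by (simp only: mult_1_right mult_minus_left mult_minus_right mult_1 minus_minus)
  then show ?thesis
    by (simp only: x)
qed

end
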